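(* Let $X$ be a partially ordered vector space with positive cone $X_+$. There exists a non-empty, order bounded and order open set in $X$ if and only if the interior $\tau_o\text{-int}(X_+)$ of $X_+$ with respect to the order topology $\tau_o(X)$ is non-empty.
   Context: A partially ordered vector space is a real vector space $X$ with a partial order $\leq$ such that $x\leq y$ implies $x+z\leq y+z$ and $\lambda x\leq\lambda y$ for all $z\in X$ and real $\lambda\geq 0$; $X_+=\{x\in X;\ x\geq 0\}$, and $[x,y]=\{z\in X;\ x\leq z\leq y\}$. A set is order bounded if it is contained in some $[x,y]$. For a net $(x_\alpha)_{\alpha\in A}$ in $X$ we write $x_\alpha\downarrow 0$ if the net is decreasing ($\alpha\leq\beta$ implies $x_\beta\leq x_\alpha$) and $\inf_{\alpha\in A} x_\alpha=0$. A set $M\subseteq X$ is net catching for $x\in X$ if for every net $(x_\alpha)_{\alpha\in A}$ in $X$ with $x_\alpha\downarrow 0$ there is $\alpha\in A$ with $[x-x_\alpha,x+x_\alpha]\subseteq M$. A set $O\subseteq X$ is order open if it is net catching for every $x\in O$. The order topology is $\tau_o(X)=\{O\subseteq X;\ O\text{ order open}\}$. *)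

theory Defs
  imports "HOL-Analysis.Analysis" "HOL-Library.Lub_Glb"
begin

(* A partially ordered vector space is the type class ordered_real_vector.  Its axiom
   scaleR_right_mono follows from the other ones: for a <= b and 0 <= x,
   scaling 0 <= x by b - a gives a x <= b x. *)

definition order_bounded :: "'a::ord set \<Rightarrow> bool" where
  "order_bounded S \<longleftrightarrow> (\<exists>a b. S \<subseteq> {a..b})"

(* (\<alpha>, \<beta>) \<in> r is read as \<alpha> \<le> \<beta>. *)
definition directed_set :: "'i set \<Rightarrow> 'i rel \<Rightarrow> bool" where
  "directed_set A r \<longleftrightarrow>
     A \<noteq> {} \<and> preorder_on A r \<and>
     (\<forall>\<alpha>\<in>A. \<forall>\<beta>\<in>A. \<exists>\<gamma>\<in>A. (\<alpha>, \<gamma>) \<in> r \<and> (\<beta>, \<gamma>) \<in> r)"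

definition net_decreases_to_0 ::
  "'i set \<Rightarrow> 'i rel \<Rightarrow> ('i \<Rightarrow> 'a::ordered_real_vector) \<Rightarrow> bool" where
  "net_decreases_to_0 A r x \<longleftrightarrow>
     directed_set A r \<and>
     (\<forall>\<alpha>\<in>A. \<forall>\<beta>\<in>A. (\<alpha>, \<beta>) \<in> r \<longrightarrow> x \<beta> \<le> x \<alpha>) \<and>
     isGlb UNIV (x ` A) 0"

(* A definition cannot quantify over all index types, so the nets range over the directed
   sets A contained in the type 'a of the space itself.  By net_catchingD below, the property
   then holds for nets indexed by directed sets of any type. *)
definition net_catching :: "'a::ordered_real_vector set \<Rightarrow> 'a \<Rightarrow> bool" where
  "net_catching M x \<longleftrightarrow>
     (\<forall>(A :: 'a set) r y. net_decreases_to_0 A r y \<longrightarrow>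
        (\<exists>\<alpha>\<in>A. {x - y \<alpha> .. x + y \<alpha>} \<subseteq> M))"

lemma net_catchingD:
  fixes A :: "'i set" and y :: "'i \<Rightarrow> 'a::ordered_real_vector"
  assumes "net_catching M x" and y: "net_decreases_to_0 A r y"
  shows "\<exists>\<alpha>\<in>A. {x - y \<alpha> .. x + y \<alpha>} \<subseteq> M"
proof -
  define s where "s = {(u, v). u \<in> y ` A \<and> v \<in> y ` A \<and> v \<le> u}"
  have "preorder_on (y ` A) s"
    by (auto simp: preorder_on_def refl_on_def trans_def s_def)
  moreover have "\<exists>w\<in>y ` A. (u, w) \<in> s \<and> (v, w) \<in> s"
    if uv: "u \<in> y ` A" "v \<in> y ` A" for u v
  proof -
    obtain \<alpha> \<beta> where ab: "\<alpha> \<in> A" "\<beta> \<in> A" "u = y \<alpha>" "v = y \<beta>"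
      using uv by auto
    then obtain \<gamma> where "\<gamma> \<in> A" "(\<alpha>, \<gamma>) \<in> r" "(\<beta>, \<gamma>) \<in> r"
      using y unfolding net_decreases_to_0_def directed_set_def by blast
    then have "y \<gamma> \<in> y ` A" "y \<gamma> \<le> u" "y \<gamma> \<le> v"
      using y ab unfolding net_decreases_to_0_def by blast+
    then show ?thesis
      using uv unfolding s_def by blast
  qed
  ultimately have "directed_set (y ` A) s"
    using y by (auto simp: net_decreases_to_0_def directed_set_def)
  then have "net_decreases_to_0 (y ` A) s (\<lambda>u. u)"
    using y by (auto simp: net_decreases_to_0_def s_def)
  then show ?thesis
    using assms(1) unfolding net_catching_def by blast
qed

definition order_open :: "'a::ordered_real_vector set \<Rightarrow> bool" where
  "order_open O' \<longleftrightarrow> (\<forall>x\<in>O'. net_catching O' x)"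

(* The name order_topology is taken by a type class. *)
definition tau_o :: "'a::ordered_real_vector topology" where
  "tau_o = topology order_open"

lemma istopology_order_open: "istopology (order_open :: 'a::ordered_real_vector set \<Rightarrow> bool)"
  unfolding istopology_def
proof (intro conjI allI impI)
  fix S T :: "'a set"
  assume S: "order_open S" and T: "order_open T"
  show "order_open (S \<inter> T)"
    unfolding order_open_def net_catching_def
  proof (intro ballI allI impI)
    fix x A r and y :: "'a \<Rightarrow> 'a"
    assume x: "x \<in> S \<inter> T" and y: "net_decreases_to_0 A r y"
    obtain \<alpha> where a: "\<alpha> \<in> A" "{x - y \<alpha> .. x + y \<alpha>} \<subseteq> S"
      using S x y unfolding order_open_def net_catching_def by blast
    obtain \<beta> where b: "\<beta> \<in> A" "{x - y \<beta> .. x + y \<beta>} \<subseteq> T"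
      using T x y unfolding order_open_def net_catching_def by blast
    obtain \<gamma> where c: "\<gamma> \<in> A" "(\<alpha>, \<gamma>) \<in> r" "(\<beta>, \<gamma>) \<in> r"
      using y a(1) b(1) unfolding net_decreases_to_0_def directed_set_def by blast
    then have le: "y \<gamma> \<le> y \<alpha>" "y \<gamma> \<le> y \<beta>"
      using y a(1) b(1) unfolding net_decreases_to_0_def by blast+
    have "{x - y \<gamma> .. x + y \<gamma>} \<subseteq> {x - y \<alpha> .. x + y \<alpha>}"
      by (intro atLeastatMost_subset_iff[THEN iffD2] disjI2 conjI diff_left_mono
          add_left_mono le)
    moreover have "{x - y \<gamma> .. x + y \<gamma>} \<subseteq> {x - y \<beta> .. x + y \<beta>}"
      by (intro atLeastatMost_subset_iff[THEN iffD2] disjI2 conjI diff_left_mono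
          add_left_mono le)
    ultimately show "\<exists>\<alpha>\<in>A. {x - y \<alpha> .. x + y \<alpha>} \<subseteq> S \<inter> T"
      using a b c by blast
  qed
next
  fix \<K> :: "'a set set"
  assume "\<forall>K\<in>\<K>. order_open K"
  then show "order_open (\<Union>\<K>)"
    unfolding order_open_def net_catching_def by (meson Union_iff Union_upper order_trans)
qed

lemma openin_tau_o: "openin tau_o = order_open"
  unfolding tau_o_def by (rule topology_inverse'[OF istopology_order_open])

end

theory Submission
  imports Defs
begin

text \<open>Order openness is invariant under translations and point reflections, since both carry
  order intervals centred at a point to order intervals of the same radius centred at its image. If
  an order open set has the lower bound \<open>a\<close>, translating it by \<open>-a\<close> puts
  it inside the cone, so the cone has interior points. Conversely, an open set \<open>U\<close> in
  the cone is bounded below by 0; intersecting it with its reflection through one of its points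
  \<open>x\<close> also bounds it above, by \<open>2x\<close>.\<close>

lemma order_open_translation_preimage:
  fixes M :: "'a::ordered_real_vector set"
  assumes "order_open M"
  shows "order_open {z. a + z \<in> M}"
  unfolding order_open_def net_catching_def
proof (intro ballI allI impI)
  fix x A r and y :: "'a \<Rightarrow> 'a"
  assume "x \<in> {z. a + z \<in> M}" and "net_decreases_to_0 A r y"
  then obtain \<alpha> where \<alpha>: "\<alpha> \<in> A" "{a + x - y \<alpha> .. a + x + y \<alpha>} \<subseteq> M"
    using assms unfolding order_open_def net_catching_def by blast
  have "a + z \<in> {a + x - y \<alpha> .. a + x + y \<alpha>}" if "z \<in> {x - y \<alpha> .. x + y \<alpha>}" for z
    using that by (simp add: algebra_simps)
  with \<alpha> show "\<exists>\<alpha>\<in>A. {x - y \<alpha> .. x + y \<alpha>} \<subseteq> {z. a + z \<in> M}"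
    by blast
qed

text \<open>The map reverses the order, but intervals \<open>[x - y, x + y]\<close> are symmetric
  about their centre, so reversal only swaps the endpoints of the image interval about
  \<open>a - x\<close>.\<close>

lemma order_open_reflection_preimage:
  fixes M :: "'a::ordered_real_vector set"
  assumes "order_open M"
  shows "order_open {z. a - z \<in> M}"
  unfolding order_open_def net_catching_def
proof (intro ballI allI impI)
  fix x A r and y :: "'a \<Rightarrow> 'a"
  assume "x \<in> {z. a - z \<in> M}" and "net_decreases_to_0 A r y"
  then obtain \<alpha> where \<alpha>: "\<alpha> \<in> A" "{a - x - y \<alpha> .. a - x + y \<alpha>} \<subseteq> M"
    using assms unfolding order_open_def net_catching_def by blast
  have "a - z \<in> {a - x - y \<alpha> .. a - x + y \<alpha>}" if "z \<in> {x - y \<alpha> .. x + y \<alpha>}" for z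
    using that by (simp add: algebra_simps)
  with \<alpha> show "\<exists>\<alpha>\<in>A. {x - y \<alpha> .. x + y \<alpha>} \<subseteq> {z. a - z \<in> M}"
    by blast
qed

theorem proposition2p1:
  shows "(\<exists>M :: 'a::ordered_real_vector set. M \<noteq> {} \<and> order_bounded M \<and> order_open M) \<longleftrightarrow>
    tau_o interior_of {x :: 'a. 0 \<le> x} \<noteq> {}"
proof
  assume "\<exists>M :: 'a set. M \<noteq> {} \<and> order_bounded M \<and> order_open M"
  then obtain M :: "'a set" and a b m where M: "m \<in> M" "M \<subseteq> {a..b}" "order_open M"
    unfolding order_bounded_def by blast
  \<comment> \<open>The set is the translate \<open>M - a\<close>; cancelling \<open>a\<close> in
    \<open>a \<le> a + z\<close> gives positivity.\<close>
  have "{z. a + z \<in> M} \<subseteq> {x. 0 \<le> x}"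
    using M(2) by fastforce
  moreover have "openin tau_o {z. a + z \<in> M}"
    using order_open_translation_preimage[OF M(3)] by (simp add: openin_tau_o)
  ultimately have "{z. a + z \<in> M} \<subseteq> tau_o interior_of {x. 0 \<le> x}"
    by (rule interior_of_maximal)
  moreover have "m - a \<in> {z. a + z \<in> M}"
    using M(1) by simp
  ultimately show "tau_o interior_of {x :: 'a. 0 \<le> x} \<noteq> {}"
    by blast
next
  assume "tau_o interior_of {x :: 'a. 0 \<le> x} \<noteq> {}"
  then obtain U and x :: 'a where U: "openin tau_o U" "x \<in> U" "U \<subseteq> {x. 0 \<le> x}"
    unfolding interior_of_def by blast
  \<comment> \<open>The reflection \<open>z \<mapsto> 2x - z\<close> fixes \<open>x\<close>, so
    \<open>x\<close> stays in the intersection, and positivity of \<open>2x - z\<close> is the upper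
    bound \<open>z \<le> 2x\<close>.\<close>
  let ?M = "U \<inter> {z. (x + x) - z \<in> U}"
  have "openin tau_o {z. (x + x) - z \<in> U}"
    using U(1) by (simp add: openin_tau_o order_open_reflection_preimage)
  then have "order_open ?M"
    using openin_Int[OF U(1)] by (simp add: openin_tau_o)
  moreover have "?M \<subseteq> {0..x + x}"
    using U(3) by fastforce
  moreover have "x \<in> ?M"
    using U(2) by simp
  ultimately show "\<exists>M :: 'a set. M \<noteq> {} \<and> order_bounded M \<and> order_open M"
    unfolding order_bounded_def by (intro exI[of _ ?M]) (metis empty_iff)
qed

end
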